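(* Let $(X,\|\cdot\|)$ be a real Banach space and let $T:X\to X$ be an enriched $\mathcal{A}$-contraction or an enriched $\mathcal{A}'$-contraction. Then the fixed point problem involving $T$ possesses the limit shadowing property in $X$.
   Context: Write $\mathbb{R}_+=[0,\infty)$. Let $\mathcal{A}$ be the collection of all mappings $f:\mathbb{R}_+^3\to\mathbb{R}$ satisfying: ($\mathcal{A}_1$) $f$ is continuous; ($\mathcal{A}_2$) there exists $k\in[0,1)$ such that for all $r,s\in\mathbb{R}_+$: if $r\le f(s,r,s)$ or $r\le f(r,s,s)$, then $r\le ks$; ($\mathcal{A}_3$) for all $\lambda>0$ and all $r,s,t\in\mathbb{R}_+$, $\lambda f(r,s,t)\le f(\lambda r,\lambda s,\lambda t)$. Let $\mathcal{A}'$ be the collection of all mappings $f:\mathbb{R}_+^3\to\mathbb{R}$ satisfying: ($\mathcal{A}'_1$) $f$ is continuous; ($\mathcal{A}'_2$) there exists $k\in[0,1)$ such that for all $r,s\in\mathbb{R}_+$: if $r\le f(r,s,s)$ or $r\le f(s,s,r)$, then $r\le ks$; ($\mathcal{A}'_3$) for all $\lambda>0$ and all $r,s,t\in\mathbb{R}_+$, $\lambda f(r,s,t)\le f(\lambda r,\lambda s,\lambda t)$; ($\mathcal{A}'_4$) for all $r,s,t,t_1\in\mathbb{R}_+$, if $t\le t_1$, then $f(r,s,t)\le f(r,s,t_1)$; ($\mathcal{A}'_5$) there exists $k\in[0,1)$ such that for all $r,s\in\mathbb{R}_+$: if $r\le f(s,0,r+s)$, then $r\le ks$; ($\mathcal{A}'_6$)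 for all $r\in\mathbb{R}_+$, if $r\le f(r,r,r)$, then $r=0$. Let $(X,\|\cdot\|)$ be a real Banach space. A mapping $T:X\to X$ is called an enriched $\mathcal{A}$-contraction if there exist $b\in[0,\infty)$ and $f\in\mathcal{A}$ such that $$\|b(u-v)+Tu-Tv\|\le f\big((b+1)\|u-v\|,\ \|u-Tu\|,\ \|v-Tv\|\big)$$ for all $u,v\in X$ with $u\ne v$. It is called an enriched $\mathcal{A}'$-contraction if there exist $b\in[0,\infty)$ and $f\in\mathcal{A}'$ such that $$\|b(u-v)+Tu-Tv\|\le f\big((b+1)\|u-v\|,\ \|(b+1)(u-v)+v-Tv\|,\ \|(b+1)(v-u)+u-Tu\|\big)$$ for all $u,v\in X$ with $u\ne v$. For a self-map $T$ of a metric space $(X,d)$, the fixed point problem involving $T$ is said to possess the limit shadowing property in $X$ if for any sequence $\{u_n\}$ in $X$ with $\lim_{n\to\infty}d(u_n,Tu_n)=0$, there exists $p\in X$ with $\lim_{n\to\infty}d(T^np,u_n)=0$. Here $d(u,v)=\|u-v\|$. *)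

theory Defs
  imports "HOL-Analysis.Analysis"
begin

definition nonneg_triples :: "(real \<times> real \<times> real) set" where
  "nonneg_triples = {0..} \<times> {0..} \<times> {0..}"

(* A map from nonneg_triples to the reals is represented by a total function whose values
   outside nonneg_triples are unconstrained: no condition below evaluates it there. *)

definition class_A :: "(real \<times> real \<times> real \<Rightarrow> real) set" where
  "class_A = {f.
     continuous_on nonneg_triples f \<and>
     (\<exists>k. 0 \<le> k \<and> k < 1 \<and>
        (\<forall>r\<ge>0. \<forall>s\<ge>0. r \<le> f (s, r, s) \<or> r \<le> f (r, s, s) \<longrightarrow> r \<le> k * s)) \<and>
     (\<forall>l>0. \<forall>r\<ge>0. \<forall>s\<ge>0. \<forall>t\<ge>0. l * f (r, s, t) \<le> f (l * r, l * s, l * t))}"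

definition class_A' :: "(real \<times> real \<times> real \<Rightarrow> real) set" where
  "class_A' = {f.
     continuous_on nonneg_triples f \<and>
     (\<exists>k. 0 \<le> k \<and> k < 1 \<and>
        (\<forall>r\<ge>0. \<forall>s\<ge>0. r \<le> f (r, s, s) \<or> r \<le> f (s, s, r) \<longrightarrow> r \<le> k * s)) \<and>
     (\<forall>l>0. \<forall>r\<ge>0. \<forall>s\<ge>0. \<forall>t\<ge>0. l * f (r, s, t) \<le> f (l * r, l * s, l * t)) \<and>
     (\<forall>r\<ge>0. \<forall>s\<ge>0. \<forall>t\<ge>0. \<forall>t1\<ge>0. t \<le> t1 \<longrightarrow> f (r, s, t) \<le> f (r, s, t1)) \<and>
     (\<exists>k. 0 \<le> k \<and> k < 1 \<and>
        (\<forall>r\<ge>0. \<forall>s\<ge>0. r \<le> f (s, 0, r + s) \<longrightarrow> r \<le> k * s)) \<and>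
     (\<forall>r\<ge>0. r \<le> f (r, r, r) \<longrightarrow> r = 0)}"

definition enriched_A_contraction :: "('a::real_normed_vector \<Rightarrow> 'a) \<Rightarrow> bool" where
  "enriched_A_contraction T \<longleftrightarrow>
     (\<exists>b\<ge>0. \<exists>f\<in>class_A. \<forall>u v. u \<noteq> v \<longrightarrow>
        norm (b *\<^sub>R (u - v) + T u - T v)
          \<le> f ((b + 1) * norm (u - v), norm (u - T u), norm (v - T v)))"

definition enriched_A'_contraction :: "('a::real_normed_vector \<Rightarrow> 'a) \<Rightarrow> bool" where
  "enriched_A'_contraction T \<longleftrightarrow>
     (\<exists>b\<ge>0. \<exists>f\<in>class_A'. \<forall>u v. u \<noteq> v \<longrightarrow>
        norm (b *\<^sub>R (u - v) + T u - T v)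
          \<le> f ((b + 1) * norm (u - v),
               norm ((b + 1) *\<^sub>R (u - v) + v - T v),
               norm ((b + 1) *\<^sub>R (v - u) + u - T u)))"

definition limit_shadowing_property :: "('a::metric_space \<Rightarrow> 'a) \<Rightarrow> bool" where
  "limit_shadowing_property T \<longleftrightarrow>
     (\<forall>u :: nat \<Rightarrow> 'a. (\<lambda>n. dist (u n) (T (u n))) \<longlonglongrightarrow> 0 \<longrightarrow>
        (\<exists>p. (\<lambda>n. dist ((T ^^ n) p) (u n)) \<longlonglongrightarrow> 0))"

end

theory Submission
  imports Defs
begin

text \<open>
  Both kinds of enriched contraction become ordinary ones for the averaged map
  \<open>S x = (b x + T x) / (b + 1)\<close>, which has the same fixed points as \<open>T\<close> and whose displacement
  \<open>x - S x\<close> is \<open>x - T x\<close> divided by \<open>b + 1\<close>. This works because the third axiom of each class,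
  used for a scalar and for its inverse, makes \<open>f\<close> positively homogeneous, so that the factor
  \<open>b + 1\<close> cancels: either \<open>\<parallel>S u - S v\<parallel> \<le> f (\<parallel>u - v\<parallel>, \<parallel>u - S u\<parallel>, \<parallel>v - S v\<parallel>)\<close> or
  \<open>\<parallel>S u - S v\<parallel> \<le> f (\<parallel>u - v\<parallel>, \<parallel>u - S v\<parallel>, \<parallel>v - S u\<parallel>)\<close>.

  The contraction axioms force consecutive Picard iterates of \<open>S\<close> to approach each other
  geometrically; by completeness they converge, and continuity of \<open>f\<close> makes the limit \<open>p\<close> a fixed
  point. The shadowing orbit is the constant orbit of \<open>p\<close>: it remains to see that every sequence
  \<open>u\<close> of approximate fixed points converges to \<open>p\<close>. Put \<open>d = \<parallel>u - p\<parallel>\<close> and \<open>e = \<parallel>u - S u\<parallel>\<close>. Then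
  \<open>d - e \<le> \<parallel>S u - S p\<parallel>\<close>, which is at most \<open>f (d, e, 0)\<close> or \<open>f (d, d, d + e)\<close>. Dividing by \<open>d\<close>
  gives \<open>1 - e / d \<le> g (e / d)\<close> with \<open>g x = f (1, x, 0)\<close> or \<open>g x = f (1, 1, 1 + x)\<close>. As \<open>g\<close> is
  continuous and \<open>g 0 < 1\<close>, the ratio \<open>e / d\<close> is bounded below by some \<open>\<delta> > 0\<close>, so
  \<open>d \<le> e / \<delta>\<close> tends to \<open>0\<close> with \<open>e\<close>. Homogeneity thus replaces any a priori bound on \<open>u\<close>.
\<close>

section \<open>Homogeneity\<close>

text \<open>The reverse inequality is the hypothesis for the scalar \<open>1 / l\<close> at the scaled point.\<close>

lemma superhomogeneous_imp_homogeneous: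
  fixes f :: "real \<times> real \<times> real \<Rightarrow> real"
  assumes super: "\<forall>l>0. \<forall>r\<ge>0. \<forall>s\<ge>0. \<forall>t\<ge>0. l * f (r, s, t) \<le> f (l * r, l * s, l * t)"
    and "l > 0" "r \<ge> 0" "s \<ge> 0" "t \<ge> 0"
  shows "f (l * r, l * s, l * t) = l * f (r, s, t)"
proof (rule antisym)
  have "1 / l * f (l * r, l * s, l * t) \<le> f (1 / l * (l * r), 1 / l * (l * s), 1 / l * (l * t))"
    using assms(2-) by (intro super[rule_format]) auto
  then show "f (l * r, l * s, l * t) \<le> l * f (r, s, t)"
    using \<open>l > 0\<close> by (simp add: field_simps)
qed (use assms in auto)

section \<open>Fixed points and approximate fixed points\<close>

lemma Picard_iterates_convergent:
  fixes S :: "'a::banach \<Rightarrow> 'a"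
  assumes k: "0 \<le> k" "k < 1"
    and step: "\<And>x. norm (S (S x) - S x) \<le> k * norm (S x - x)"
  shows "convergent (\<lambda>n. (S ^^ n) x)"
proof -
  have bound: "norm ((S ^^ Suc n) x - (S ^^ n) x) \<le> norm (S x - x) * k ^ n" for n
  proof (induction n)
    case (Suc n)
    have "norm ((S ^^ Suc (Suc n)) x - (S ^^ Suc n) x) \<le> k * norm ((S ^^ Suc n) x - (S ^^ n) x)"
      using step[of "(S ^^ n) x"] by simp
    also have "\<dots> \<le> k * (norm (S x - x) * k ^ n)"
      using Suc k by (intro mult_left_mono) auto
    finally show ?case by (simp add: mult_ac)
  qed simp
  have "summable (\<lambda>n. norm (S x - x) * k ^ n)"
    using k by (intro summable_mult summable_geometric) simp
  then have "summable (\<lambda>n. (S ^^ Suc n) x - (S ^^ n) x)"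
    by (rule summable_comparison_test') (rule bound)
  then have "convergent (\<lambda>n. \<Sum>i<n. (S ^^ Suc i) x - (S ^^ i) x)"
    by (simp add: summable_iff_convergent)
  moreover have "(\<Sum>i<n. (S ^^ Suc i) x - (S ^^ i) x) = (S ^^ n) x - x" for n
    by (subst sum_lessThan_telescope) simp
  ultimately have "convergent (\<lambda>n. (S ^^ n) x - x + x)"
    by (intro convergent_add convergent_const) simp
  then show ?thesis by simp
qed

text \<open>
  Contraction inequalities are available only at distinct points, whereas an orbit may hit its own
  limit. If it does so infinitely often, then \<open>S p\<close> is a cluster point of the orbit and equals
  \<open>p\<close>; otherwise the inequality passes to the limit.
\<close>

lemma norm_Picard_limit_le:
  fixes S :: "'a::real_normed_vector \<Rightarrow> 'a"
  assumes lim: "(\<lambda>n. (S ^^ n) x) \<longlonglongrightarrow> p"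
    and h: "h \<longlonglongrightarrow> c"
    and le: "\<And>n. (S ^^ n) x \<noteq> p \<Longrightarrow> norm (S p - (S ^^ Suc n) x) \<le> h n"
    and "S p \<noteq> p"
  shows "norm (p - S p) \<le> c"
proof -
  have conv: "(\<lambda>n. norm (S p - (S ^^ Suc n) x)) \<longlonglongrightarrow> norm (S p - p)"
    by (intro tendsto_intros LIMSEQ_Suc[OF lim])
  have "norm (S p - p) > 0" using \<open>S p \<noteq> p\<close> by simp
  then have "\<forall>\<^sub>F n in sequentially. norm (S p - (S ^^ Suc n) x) > 0"
    using conv by (rule order_tendstoD(1)[rotated])
  then have "\<forall>\<^sub>F n in sequentially. norm (S p - (S ^^ Suc n) x) \<le> h n"
  proof eventually_elim
    case (elim n)
    then have "(S ^^ n) x \<noteq> p" by auto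
    then show ?case by (rule le)
  qed
  then have "norm (S p - p) \<le> c"
    using conv h by (intro tendsto_le[OF sequentially_bot])
  then show ?thesis by (simp add: norm_minus_commute)
qed

text \<open>
  Here \<open>d\<close> is the distance to a fixed point and \<open>e\<close> the displacement; the hypothesis relates them
  only through the ratio \<open>e / d\<close>, so continuity of \<open>g\<close> at the single point \<open>0\<close> gives a linear
  estimate, whatever the size of \<open>d\<close>.
\<close>

lemma distance_le_displacement:
  fixes g :: "real \<Rightarrow> real"
  assumes g: "continuous_on {0..} g" "g 0 < 1"
  obtains \<delta> where "\<delta> > 0"
    "\<And>d e. d > 0 \<Longrightarrow> e \<ge> 0 \<Longrightarrow> d - e \<le> d * g (e / d) \<Longrightarrow> d \<le> e / \<delta>"
proof -
  have "((\<lambda>x. g x + x) \<longlongrightarrow> g 0 + 0) (at 0 within {0..})"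
    using g(1) by (intro tendsto_intros) (simp add: continuous_on)
  then have "\<forall>\<^sub>F x in at 0 within {0..}. g x + x < 1"
    using g(2) by (intro order_tendstoD) auto
  then obtain \<delta> where \<delta>: "\<delta> > 0"
    and small: "\<And>x. x \<ge> 0 \<Longrightarrow> x \<noteq> 0 \<Longrightarrow> dist x 0 < \<delta> \<Longrightarrow> g x + x < 1"
    unfolding eventually_at by auto
  have "d \<le> e / \<delta>" if "d > 0" "e \<ge> 0" and le: "d - e \<le> d * g (e / d)" for d e
  proof (rule ccontr)
    assume "\<not> d \<le> e / \<delta>"
    then have "e / d < \<delta>" using \<delta> \<open>d > 0\<close> by (simp add: field_simps)
    then have "g (e / d) + e / d < 1"
      using small[of "e / d"] g(2) that(1,2) by (cases "e = 0") auto
    then have "d * (g (e / d) + e / d) < d * 1"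
      using \<open>d > 0\<close> by (intro mult_strict_left_mono)
    then show False using le \<open>d > 0\<close> by (simp add: algebra_simps)
  qed
  with \<delta> show ?thesis by (rule that)
qed

section \<open>The averaged map\<close>

definition averaged :: "real \<Rightarrow> ('a::real_vector \<Rightarrow> 'a) \<Rightarrow> 'a \<Rightarrow> 'a" where
  "averaged b T x = (1 / (b + 1)) *\<^sub>R (b *\<^sub>R x + T x)"

lemma scaleR_averaged:
  assumes "b \<ge> 0"
  shows "(b + 1) *\<^sub>R averaged b T x = b *\<^sub>R x + T x"
  using assms by (simp add: averaged_def)

lemma displacement_averaged:
  assumes "b \<ge> 0"
  shows "x - T x = (b + 1) *\<^sub>R (x - averaged b T x)"
  using scaleR_averaged[OF assms, of T x] by (simp add: algebra_simps)

lemma difference_averaged: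
  assumes "b \<ge> 0"
  shows "b *\<^sub>R (u - v) + T u - T v = (b + 1) *\<^sub>R (averaged b T u - averaged b T v)"
  using scaleR_averaged[OF assms, of T u] scaleR_averaged[OF assms, of T v]
  by (simp add: scaleR_diff_right)

lemma cross_displacement_averaged:
  assumes "b \<ge> 0"
  shows "(b + 1) *\<^sub>R (u - v) + v - T v = (b + 1) *\<^sub>R (u - averaged b T v)"
  using displacement_averaged[OF assms, of v T] by (simp add: algebra_simps)

lemma averaged_fixed_point_iff:
  assumes "b \<ge> 0"
  shows "averaged b T p = p \<longleftrightarrow> T p = p"
proof -
  have "p - averaged b T p = 0 \<longleftrightarrow> p - T p = 0"
    using displacement_averaged[OF assms, of p T] assms by simp
  then show ?thesis by (metis eq_iff_diff_eq_0)
qed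

text \<open>
  The part of the argument common to both classes. Since every approximate fixed point sequence
  converges to the fixed point \<open>p\<close>, the orbit that shadows it is constant.
\<close>

lemma limit_shadowing_via_averaged:
  fixes T :: "'a::banach \<Rightarrow> 'a" and b :: real
  defines "S \<equiv> averaged b T"
  assumes b: "b \<ge> 0"
    and k: "0 \<le> k" "k < 1"
    and step: "\<And>x. S x \<noteq> x \<Longrightarrow> norm (S (S x) - S x) \<le> k * norm (S x - x)"
    and limit: "\<And>x p. (\<lambda>n. (S ^^ n) x) \<longlonglongrightarrow> p \<Longrightarrow> S p = p"
    and g: "continuous_on {0..} g" "g 0 < 1"
    and approx: "\<And>u p. S p = p \<Longrightarrow> u \<noteq> p \<Longrightarrow>
      norm (S u - S p) \<le> norm (u - p) * g (norm (u - S u) / norm (u - p))"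
  shows "limit_shadowing_property T"
proof -
  have "norm (S (S x) - S x) \<le> k * norm (S x - x)" for x
    by (cases "S x = x") (use step in auto)
  then obtain p where p: "S p = p"
    using Picard_iterates_convergent[OF k] limit by (metis convergent_def)
  then have "T p = p" using averaged_fixed_point_iff[OF b, of T p] by (simp add: S_def)
  then have orbit: "(T ^^ n) p = p" for n by (induction n) auto
  obtain \<delta> where \<delta>: "\<delta> > 0"
    "\<And>d e. d > 0 \<Longrightarrow> e \<ge> 0 \<Longrightarrow> d - e \<le> d * g (e / d) \<Longrightarrow> d \<le> e / \<delta>"
    using distance_le_displacement[OF g] by blast
  have le: "norm (x - p) \<le> norm (x - S x) / \<delta>" for x
  proof (cases "x = p")
    case False
    have "norm (x - p) \<le> norm (x - S x) + norm (S x - S p)"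
      unfolding p using norm_triangle_ineq[of "x - S x" "S x - p"] by simp
    with approx[OF p False] show ?thesis by (intro \<delta>(2)) (use False in auto)
  qed (use \<delta>(1) in auto)
  have displacement: "norm (x - S x) = dist x (T x) / (b + 1)" for x
    using displacement_averaged[OF b, of x T] b by (simp add: S_def dist_norm)
  show ?thesis
    unfolding limit_shadowing_property_def
  proof (intro allI impI exI)
    fix u :: "nat \<Rightarrow> 'a"
    assume u: "(\<lambda>n. dist (u n) (T (u n))) \<longlonglongrightarrow> 0"
    have "(\<lambda>n. dist (u n) (T (u n)) / (b + 1) / \<delta>) \<longlonglongrightarrow> 0 / (b + 1) / \<delta>"
      using b \<delta>(1) by (intro tendsto_intros u) auto
    then have lim: "(\<lambda>n. norm (u n - S (u n)) / \<delta>) \<longlonglongrightarrow> 0"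
      unfolding displacement by simp
    have "\<forall>\<^sub>F n in sequentially. norm (u n - p) \<le> norm (u n - S (u n)) / \<delta>"
      by (rule always_eventually) (rule allI, rule le)
    from Lim_null_comparison[OF this lim]
    have "(\<lambda>n. norm (u n - p)) \<longlonglongrightarrow> 0"
      by (rule tendsto_norm_zero)
    then show "(\<lambda>n. dist ((T ^^ n) p) (u n)) \<longlonglongrightarrow> 0"
      by (simp add: orbit dist_norm norm_minus_commute)
  qed
qed

section \<open>The two classes of contractions\<close>

lemma tendsto_on_nonneg_triples:
  assumes f: "continuous_on nonneg_triples f"
    and lim: "F \<longlonglongrightarrow> r" "G \<longlonglongrightarrow> s" "H \<longlonglongrightarrow> t"
    and nonneg: "\<And>n. F n \<ge> 0" "\<And>n. G n \<ge> 0" "\<And>n. H n \<ge> 0"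
  shows "(\<lambda>n. f (F n, G n, H n)) \<longlonglongrightarrow> f (r, s, t)"
proof (rule continuous_on_tendsto_compose[OF f])
  show "(\<lambda>n. (F n, G n, H n)) \<longlonglongrightarrow> (r, s, t)" by (intro tendsto_intros lim)
  have "r \<ge> 0" "s \<ge> 0" "t \<ge> 0"
    using lim[THEN LIMSEQ_le_const, of 0] nonneg by simp_all
  then show "(r, s, t) \<in> nonneg_triples" by (simp add: nonneg_triples_def)
  show "\<forall>\<^sub>F n in sequentially. (F n, G n, H n) \<in> nonneg_triples"
    using nonneg by (simp add: nonneg_triples_def)
qed

lemma enriched_A_contraction_limit_shadowing:
  fixes T :: "'a::banach \<Rightarrow> 'a"
  assumes "enriched_A_contraction T"
  shows "limit_shadowing_property T"
proof -
  obtain b f where b: "b \<ge> 0" and f: "f \<in> class_A"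
    and T: "\<And>u v. u \<noteq> v \<Longrightarrow> norm (b *\<^sub>R (u - v) + T u - T v)
          \<le> f ((b + 1) * norm (u - v), norm (u - T u), norm (v - T v))"
    using assms unfolding enriched_A_contraction_def by blast
  have cont: "continuous_on nonneg_triples f"
    and super: "\<forall>l>0. \<forall>r\<ge>0. \<forall>s\<ge>0. \<forall>t\<ge>0. l * f (r, s, t) \<le> f (l * r, l * s, l * t)"
    and contr_ex: "\<exists>k. 0 \<le> k \<and> k < 1 \<and>
      (\<forall>r\<ge>0. \<forall>s\<ge>0. r \<le> f (s, r, s) \<or> r \<le> f (r, s, s) \<longrightarrow> r \<le> k * s)"
    using f by (simp_all add: class_A_def)
  obtain k where k: "0 \<le> k" "k < 1"
    and contr1: "\<And>r s. r \<ge> 0 \<Longrightarrow> s \<ge> 0 \<Longrightarrow> r \<le> f (s, r, s) \<Longrightarrow> r \<le> k * s"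
    and contr2: "\<And>r s. r \<ge> 0 \<Longrightarrow> s \<ge> 0 \<Longrightarrow> r \<le> f (r, s, s) \<Longrightarrow> r \<le> k * s"
    using contr_ex by auto
  note hom = superhomogeneous_imp_homogeneous[OF super]
  define S where "S = averaged b T"
  have S: "norm (S u - S v) \<le> f (norm (u - v), norm (u - S u), norm (v - S v))" if "u \<noteq> v" for u v
  proof -
    have "(b + 1) * norm (S u - S v)
        \<le> f ((b + 1) * norm (u - v), (b + 1) * norm (u - S u), (b + 1) * norm (v - S v))"
      using T[OF that] b
      unfolding difference_averaged[OF b, of _ _ T] displacement_averaged[OF b, of _ T] S_def by simp
    then show ?thesis using b by (simp add: hom)
  qed
  show ?thesis
  proof (rule limit_shadowing_via_averaged[OF b k, of T "\<lambda>x. f (1, x, 0)", folded S_def])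
    fix x assume "S x \<noteq> x"
    \<comment> \<open>The new point comes first, so that the unknown distance is the second argument of \<open>f\<close>.\<close>
    from S[OF this] show "norm (S (S x) - S x) \<le> k * norm (S x - x)"
      by (intro contr1) (auto simp: norm_minus_commute)
  next
    fix x p assume lim: "(\<lambda>n. (S ^^ n) x) \<longlonglongrightarrow> p"
    let ?h = "\<lambda>n. f (norm (p - (S ^^ n) x), norm (p - S p), norm ((S ^^ n) x - (S ^^ Suc n) x))"
    have h: "?h \<longlonglongrightarrow> f (norm (p - p), norm (p - S p), norm (p - p))"
      by (intro tendsto_on_nonneg_triples[OF cont] tendsto_intros lim LIMSEQ_Suc[OF lim]) auto
    show "S p = p"
    proof (rule ccontr)
      assume "S p \<noteq> p"
      have "norm (p - S p) \<le> f (norm (p - p), norm (p - S p), norm (p - p))"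
        by (rule norm_Picard_limit_le[OF lim h _ \<open>S p \<noteq> p\<close>]) (use S[of p] in force)
      then have "norm (p - S p) \<le> k * 0" by (intro contr1) auto
      with \<open>S p \<noteq> p\<close> show False by simp
    qed
  next
    show "continuous_on {0..} (\<lambda>x. f (1, x, 0))"
      by (rule continuous_on_compose2[OF cont])
         (auto intro!: continuous_intros simp: nonneg_triples_def)
    show "f (1, 0, 0) < 1" using contr2[of 1 0] by force
  next
    fix u p assume p: "S p = p" and "u \<noteq> p"
    then have "norm (S u - S p) \<le> f (norm (u - p), norm (u - S u), 0)"
      using S[of u p] by simp
    also have "\<dots> = norm (u - p) * f (1, norm (u - S u) / norm (u - p), 0)"
      using hom[of "norm (u - p)" 1 "norm (u - S u) / norm (u - p)" 0] \<open>u \<noteq> p\<close> by simp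
    finally show "norm (S u - S p) \<le> norm (u - p) * f (1, norm (u - S u) / norm (u - p), 0)" .
  qed
qed

lemma enriched_A'_contraction_limit_shadowing:
  fixes T :: "'a::banach \<Rightarrow> 'a"
  assumes "enriched_A'_contraction T"
  shows "limit_shadowing_property T"
proof -
  obtain b f where b: "b \<ge> 0" and f: "f \<in> class_A'"
    and T: "\<And>u v. u \<noteq> v \<Longrightarrow> norm (b *\<^sub>R (u - v) + T u - T v)
          \<le> f ((b + 1) * norm (u - v),
               norm ((b + 1) *\<^sub>R (u - v) + v - T v),
               norm ((b + 1) *\<^sub>R (v - u) + u - T u))"
    using assms unfolding enriched_A'_contraction_def by blast
  have cont: "continuous_on nonneg_triples f"
    and super: "\<forall>l>0. \<forall>r\<ge>0. \<forall>s\<ge>0. \<forall>t\<ge>0. l * f (r, s, t) \<le> f (l * r, l * s, l * t)"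
    and mono: "\<And>r s t t1. r \<ge> 0 \<Longrightarrow> s \<ge> 0 \<Longrightarrow> t \<ge> 0 \<Longrightarrow> t \<le> t1 \<Longrightarrow> f (r, s, t) \<le> f (r, s, t1)"
    and diagonal: "\<And>r. r \<ge> 0 \<Longrightarrow> r \<le> f (r, r, r) \<Longrightarrow> r = 0"
    and contr_ex: "\<exists>k. 0 \<le> k \<and> k < 1 \<and>
      (\<forall>r\<ge>0. \<forall>s\<ge>0. r \<le> f (r, s, s) \<or> r \<le> f (s, s, r) \<longrightarrow> r \<le> k * s)"
    and orbital_ex: "\<exists>k. 0 \<le> k \<and> k < 1 \<and>
      (\<forall>r\<ge>0. \<forall>s\<ge>0. r \<le> f (s, 0, r + s) \<longrightarrow> r \<le> k * s)"
    using f by (simp_all add: class_A'_def)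
  obtain k' where contr: "\<And>r s. r \<ge> 0 \<Longrightarrow> s \<ge> 0 \<Longrightarrow> r \<le> f (s, s, r) \<Longrightarrow> r \<le> k' * s"
    using contr_ex by metis
  obtain k where k: "0 \<le> k" "k < 1"
    and orbital: "\<And>r s. r \<ge> 0 \<Longrightarrow> s \<ge> 0 \<Longrightarrow> r \<le> f (s, 0, r + s) \<Longrightarrow> r \<le> k * s"
    using orbital_ex by metis
  note hom = superhomogeneous_imp_homogeneous[OF super]
  define S where "S = averaged b T"
  have S: "norm (S u - S v) \<le> f (norm (u - v), norm (u - S v), norm (v - S u))" if "u \<noteq> v" for u v
  proof -
    have "(b + 1) * norm (S u - S v)
        \<le> f ((b + 1) * norm (u - v), (b + 1) * norm (u - S v), (b + 1) * norm (v - S u))"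
      using T[OF that] b
      unfolding difference_averaged[OF b, of _ _ T] cross_displacement_averaged[OF b, of _ _ T] S_def
      by simp
    then show ?thesis using b by (simp add: hom)
  qed
  show ?thesis
  proof (rule limit_shadowing_via_averaged[OF b k, of T "\<lambda>x. f (1, 1, 1 + x)", folded S_def])
    fix x assume "S x \<noteq> x"
    \<comment> \<open>The new point comes first, so that the second argument of \<open>f\<close> vanishes.\<close>
    then have "norm (S (S x) - S x) \<le> f (norm (S x - x), 0, norm (x - S (S x)))"
      using S[of "S x" x] by simp
    also have "norm (x - S (S x)) \<le> norm (S (S x) - S x) + norm (S x - x)"
      using norm_triangle_ineq[of "S (S x) - S x" "S x - x"] by (simp add: norm_minus_commute)
    then have "f (norm (S x - x), 0, norm (x - S (S x)))
        \<le> f (norm (S x - x), 0, norm (S (S x) - S x) + norm (S x - x))"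
      by (intro mono) auto
    finally show "norm (S (S x) - S x) \<le> k * norm (S x - x)"
      by (intro orbital) auto
  next
    fix x p assume lim: "(\<lambda>n. (S ^^ n) x) \<longlonglongrightarrow> p"
    let ?h = "\<lambda>n. f (norm (p - (S ^^ n) x), norm (p - (S ^^ Suc n) x), norm ((S ^^ n) x - S p))"
    have h: "?h \<longlonglongrightarrow> f (norm (p - p), norm (p - p), norm (p - S p))"
      by (intro tendsto_on_nonneg_triples[OF cont] tendsto_intros lim LIMSEQ_Suc[OF lim]) auto
    show "S p = p"
    proof (rule ccontr)
      assume "S p \<noteq> p"
      have "norm (p - S p) \<le> f (norm (p - p), norm (p - p), norm (p - S p))"
        by (rule norm_Picard_limit_le[OF lim h _ \<open>S p \<noteq> p\<close>]) (use S[of p] in force)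
      then have "norm (p - S p) \<le> k' * 0" by (intro contr) auto
      with \<open>S p \<noteq> p\<close> show False by simp
    qed
  next
    show "continuous_on {0..} (\<lambda>x. f (1, 1, 1 + x))"
      by (rule continuous_on_compose2[OF cont])
         (auto intro!: continuous_intros simp: nonneg_triples_def)
    show "f (1, 1, 1 + 0) < 1" using diagonal[of 1] by force
  next
    fix u p assume p: "S p = p" and "u \<noteq> p"
    then have "norm (S u - S p) \<le> f (norm (u - p), norm (u - p), norm (p - S u))"
      using S[of u p] by simp
    also have "norm (p - S u) \<le> norm (u - p) + norm (u - S u)"
      using norm_triangle_ineq[of "p - u" "u - S u"] by (simp add: norm_minus_commute)
    then have "f (norm (u - p), norm (u - p), norm (p - S u))
        \<le> f (norm (u - p), norm (u - p), norm (u - p) + norm (u - S u))"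
      by (intro mono) auto
    also have "\<dots> = norm (u - p) * f (1, 1, 1 + norm (u - S u) / norm (u - p))"
      using hom[of "norm (u - p)" 1 1 "1 + norm (u - S u) / norm (u - p)"] \<open>u \<noteq> p\<close>
      by (simp add: distrib_left)
    finally show "norm (S u - S p)
        \<le> norm (u - p) * f (1, 1, 1 + norm (u - S u) / norm (u - p))" .
  qed
qed

theorem theorem3p17:
  fixes T :: "'a::banach \<Rightarrow> 'a"
  assumes "enriched_A_contraction T \<or> enriched_A'_contraction T"
  shows "limit_shadowing_property T"
  using assms enriched_A_contraction_limit_shadowing enriched_A'_contraction_limit_shadowing
  by blast

end
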